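(* Let $d\ge 1$ and let $0\le g_a,g_b\le d$ be integers, and let $\mathcal{I}=\{|g_a-g_b|,\,|g_a-g_b|+2,\,\dots,\,g_a+g_b\}$. Let $\mathbf{A}$ and $\mathbf{B}$ be full homogeneous multivectors of grades $g_a$ and $g_b$. Then the number $p_*^{\rm th}$ of arithmetic operations involved in the geometric product $\mathbf{A}*\mathbf{B}$ is $$p_*^{\rm th}=2\sum_{g_c\in\mathcal{I}}\binom{d}{g_c}\binom{g_c}{\frac{g_a-g_b+g_c}{2}}\binom{d-g_c}{\frac{g_a+g_b-g_c}{2}},$$ with the convention $\binom{n}{k}=0$ whenever $k<0$ or $k>n$ (in particular when $n<0$).
   Context: Work in the geometric algebra over a $d$-dimensional vector space with orthogonal basis $\mathbf{e}_1,\dots,\mathbf{e}_d$ and diagonal non-degenerate metric ($\mathbf{e}_i\mathbf{e}_i=m_i\neq 0$). For $\mu\subseteq\{1,\dots,d\}$, $\mathbf{e}_\mu=\mathbf{e}_{\mu_1}\wedge\cdots\wedge\mathbf{e}_{\mu_g}$ ($\mu_1<\dots<\mu_g$) is the basis blade of grade $|\mu|$. A full homogeneous multivector of grade $g$ is $\sum_{|\mu|=g}a_\mu\mathbf{e}_\mu$ over all subsets of size $g$ with all coefficients non-zero. For basis blades the geometric product $\mathbf{e}_\mu*\mathbf{e}_\nu$ equals a non-zero scalar times $\mathbf{e}_{\mu\triangle\nu}$ ($\triangle$ = symmetric difference), whose grade lies in $\mathcal{I}$. The geometric product $\mathbf{A}*\mathbf{B}$ is computed by distributivity over the double sum; the number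 of arithmetic operations counts one multiplication and one addition for each ordered pair $(\mu,\nu)$ with $|\mu|=g_a$, $|\nu|=g_b$ whose basis-blade product is non-zero (grouped by the grade $g_c=|\mu\triangle\nu|$ of the result); sign computations are not counted. *)

theory Defs
  imports Complex_Main
begin

text \<open>
  Geometric algebra over a \<open>d\<close>-dimensional vector space with orthogonal basis
  \<open>e\<^sub>1, \<dots>, e\<^sub>d\<close> and \<open>e\<^sub>i e\<^sub>i = m i\<close>.  A multivector is given by its coefficients with
  respect to the basis blades \<open>e\<^sub>\<mu>\<close>, \<open>\<mu> \<subseteq> {1..d}\<close>; only the values at subsets of \<open>{1..d}\<close>
  are meaningful.
\<close>

type_synonym 'a multivector = "nat set \<Rightarrow> 'a"

definition blade :: "nat set \<Rightarrow> 'a::field multivector" where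
  "blade \<mu> = (\<lambda>\<rho>. if \<rho> = \<mu> then 1 else 0)"

text \<open>
  The scalar \<open>c\<close> in \<open>e\<^sub>\<mu> * e\<^sub>\<nu> = c e\<^bsub>\<mu> \<triangle> \<nu>\<^esub>\<close>: sorting the concatenation of the increasing
  words for \<open>\<mu>\<close> and \<open>\<nu>\<close> costs one sign per inversion, and every index occurring twice
  contributes \<open>e\<^sub>i e\<^sub>i = m i\<close>.
\<close>

definition blade_coeff :: "(nat \<Rightarrow> 'a::field) \<Rightarrow> nat set \<Rightarrow> nat set \<Rightarrow> 'a" where
  "blade_coeff m \<mu> \<nu> =
     (- 1) ^ card {(i, j). i \<in> \<mu> \<and> j \<in> \<nu> \<and> j < i} * (\<Prod>i\<in>\<mu> \<inter> \<nu>. m i)"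

definition geom_prod ::
  "nat \<Rightarrow> (nat \<Rightarrow> 'a::field) \<Rightarrow> 'a multivector \<Rightarrow> 'a multivector \<Rightarrow> 'a multivector" where
  "geom_prod d m A B = (\<lambda>\<rho>. \<Sum>\<mu>\<in>Pow {1..d}. \<Sum>\<nu>\<in>Pow {1..d}.
     A \<mu> * B \<nu> * (blade_coeff m \<mu> \<nu> * blade (sym_diff \<mu> \<nu>) \<rho>))"

definition full_homogeneous :: "nat \<Rightarrow> nat \<Rightarrow> 'a::field multivector \<Rightarrow> bool" where
  "full_homogeneous d g A \<longleftrightarrow>
     (\<exists>a. (\<forall>\<mu>. \<mu> \<subseteq> {1..d} \<and> card \<mu> = g \<longrightarrow> a \<mu> \<noteq> 0) \<and>
          A = (\<lambda>\<rho>. \<Sum>\<mu> | \<mu> \<subseteq> {1..d} \<and> card \<mu> = g. a \<mu> * blade \<mu> \<rho>))"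

text \<open>
  Cost of evaluating \<open>A * B\<close> by distributivity: one multiplication and one addition for
  each pair of blades that are present in \<open>A\<close> and in \<open>B\<close> and have a non-zero geometric
  product.  For full homogeneous multivectors of grades \<open>g\<^sub>a\<close> and \<open>g\<^sub>b\<close> the blades present
  are precisely those of grade \<open>g\<^sub>a\<close> and \<open>g\<^sub>b\<close>.  Sign computations are not counted.
\<close>

definition contributing_pairs ::
  "nat \<Rightarrow> (nat \<Rightarrow> 'a::field) \<Rightarrow> 'a multivector \<Rightarrow> 'a multivector \<Rightarrow> (nat set \<times> nat set) set" where
  "contributing_pairs d m A B =
     {(\<mu>, \<nu>). \<mu> \<subseteq> {1..d} \<and> \<nu> \<subseteq> {1..d} \<and> A \<mu> \<noteq> 0 \<and> B \<nu> \<noteq> 0 \<and>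
              geom_prod d m (blade \<mu>) (blade \<nu>) \<noteq> (\<lambda>_. 0)}"

definition geom_prod_ops ::
  "nat \<Rightarrow> (nat \<Rightarrow> 'a::field) \<Rightarrow> 'a multivector \<Rightarrow> 'a multivector \<Rightarrow> nat" where
  "geom_prod_ops d m A B = (\<Sum>(\<mu>, \<nu>)\<in>contributing_pairs d m A B. 1 + 1)"

text \<open>The set \<open>{\<bar>g\<^sub>a - g\<^sub>b\<bar>, \<bar>g\<^sub>a - g\<^sub>b\<bar> + 2, \<dots>, g\<^sub>a + g\<^sub>b}\<close>.\<close>

definition grade_set :: "int \<Rightarrow> int \<Rightarrow> int set" where
  "grade_set ga gb = {g. \<exists>k::nat. g = \<bar>ga - gb\<bar> + 2 * int k \<and> g \<le> ga + gb}"

text \<open>Integer arguments, because \<open>d - g\<close> is negative for grades \<open>g > d\<close> in the grade set.\<close>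

definition binom :: "int \<Rightarrow> int \<Rightarrow> int" where
  "binom n k = (if k < 0 \<or> k > n then 0 else int (nat n choose nat k))"


text \<open>
  Sanity checks: \<^const>\<open>geom_prod\<close> is associative and satisfies the defining relations of
  the geometric algebra, and every blade is the ordered product of its basis vectors.
\<close>

lemma geom_prod_blade:
  assumes "\<mu> \<subseteq> {1..d}" "\<nu> \<subseteq> {1..d}"
  shows "geom_prod d m (blade \<mu>) (blade \<nu>) =
           (\<lambda>\<rho>. blade_coeff m \<mu> \<nu> * blade (sym_diff \<mu> \<nu>) \<rho>)"
proof
  fix \<rho>
  let ?f = "\<lambda>\<mu>' \<nu>'. blade_coeff m \<mu>' \<nu>' * blade (sym_diff \<mu>' \<nu>') \<rho>"
  have "geom_prod d m (blade \<mu>) (blade \<nu>) \<rho> =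
     (\<Sum>\<mu>'\<in>Pow {1..d}. if \<mu>' = \<mu> then (\<Sum>\<nu>'\<in>Pow {1..d}. if \<nu>' = \<nu> then ?f \<mu>' \<nu>' else 0) else 0)"
    unfolding geom_prod_def
  proof (rule sum.cong[OF refl])
    fix \<mu>' assume "\<mu>' \<in> Pow {1..d}"
    show "(\<Sum>\<nu>'\<in>Pow {1..d}. blade \<mu> \<mu>' * blade \<nu> \<nu>' * ?f \<mu>' \<nu>') =
        (if \<mu>' = \<mu> then (\<Sum>\<nu>'\<in>Pow {1..d}. if \<nu>' = \<nu> then ?f \<mu>' \<nu>' else 0) else 0)"
    proof (cases "\<mu>' = \<mu>")
      case True
      have "(\<Sum>\<nu>'\<in>Pow {1..d}. blade \<mu> \<mu>' * blade \<nu> \<nu>' * ?f \<mu>' \<nu>') =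
          (\<Sum>\<nu>'\<in>Pow {1..d}. if \<nu>' = \<nu> then ?f \<mu>' \<nu>' else 0)"
        by (rule sum.cong[OF refl]) (simp add: True blade_def[of \<mu>] blade_def[of \<nu>])
      with True show ?thesis by simp
    qed (simp add: blade_def[of \<mu>])
  qed
  also have "\<dots> = blade_coeff m \<mu> \<nu> * blade (sym_diff \<mu> \<nu>) \<rho>"
    using assms by (simp add: sum.delta)
  finally show "geom_prod d m (blade \<mu>) (blade \<nu>) \<rho> = blade_coeff m \<mu> \<nu> * blade (sym_diff \<mu> \<nu>) \<rho>" .
qed

lemma geom_prod_one:
  assumes "\<mu> \<subseteq> {1..d}"
  shows "geom_prod d m (blade {}) (blade \<mu>) = blade \<mu>"
    and "geom_prod d m (blade \<mu>) (blade {}) = blade \<mu>"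
  using assms by (simp_all add: geom_prod_blade blade_coeff_def)

lemma geom_prod_square:
  assumes "i \<in> {1..d}"
  shows "geom_prod d m (blade {i}) (blade {i}) = (\<lambda>\<rho>. m i * blade {} \<rho>)"
proof -
  have "{(k, j). k \<in> {i} \<and> j \<in> {i} \<and> j < k} = {}" by auto
  then have "blade_coeff m {i} {i} = m i" unfolding blade_coeff_def by (simp only:) simp
  then show ?thesis using assms by (simp add: geom_prod_blade)
qed

lemma geom_prod_anticommute:
  assumes "i \<in> {1..d}" "j \<in> {1..d}" "i < j"
  shows "geom_prod d m (blade {i}) (blade {j}) = blade {i, j}"
    and "geom_prod d m (blade {j}) (blade {i}) = (\<lambda>\<rho>. - blade {i, j} \<rho>)"
proof -
  have 1: "{(k, l). k \<in> {i} \<and> l \<in> {j} \<and> l < k} = {}"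
    and 2: "{(k, l). k \<in> {j} \<and> l \<in> {i} \<and> l < k} = {(j, i)}" using assms by auto
  have 3: "sym_diff {i} {j} = {i, j}" "sym_diff {j} {i} = {i, j}" using assms by auto
  have 4: "{i} \<inter> {j} = {}" "{j} \<inter> {i} = {}" using assms by auto
  have "blade_coeff m {i} {j} = 1" "blade_coeff m {j} {i} = - 1"
    unfolding blade_coeff_def 1 2 4 by simp_all
  then show "geom_prod d m (blade {i}) (blade {j}) = blade {i, j}"
    and "geom_prod d m (blade {j}) (blade {i}) = (\<lambda>\<rho>. - blade {i, j} \<rho>)"
    using assms(1,2) geom_prod_blade[of "{i}" d "{j}" m] geom_prod_blade[of "{j}" d "{i}" m]
    unfolding 3 by simp_all
qed

lemma geom_prod_ordered:
  assumes "i \<in> {1..d}" "\<mu> \<subseteq> {1..d}" "\<And>j. j \<in> \<mu> \<Longrightarrow> i < j"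
  shows "geom_prod d m (blade {i}) (blade \<mu>) = blade (insert i \<mu>)"
proof -
  have 1: "{(k, l). k \<in> {i} \<and> l \<in> \<mu> \<and> l < k} = {}" using assms(3) by force
  have 2: "sym_diff {i} \<mu> = insert i \<mu>" "{i} \<inter> \<mu> = {}" using assms(3) by auto
  have "blade_coeff m {i} \<mu> = 1" unfolding blade_coeff_def 1 2 by simp
  then show ?thesis
    using assms(1,2) geom_prod_blade[of "{i}" d \<mu> m] unfolding 2 by simp
qed

lemma neg_one_power_card_sym_diff:
  assumes "finite X" "finite Y"
  shows "(- 1 :: 'a::field) ^ card (sym_diff X Y) = (- 1) ^ card X * (- 1) ^ card Y"
proof -
  have "card (sym_diff X Y) = card (X - Y) + card (Y - X)"
    using assms by (intro card_Un_disjoint) auto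
  moreover have "card X = card (X - Y) + card (X \<inter> Y)" "card Y = card (Y - X) + card (X \<inter> Y)"
    using assms by (subst card_Un_disjoint[symmetric]; auto intro!: arg_cong[where f = card])+
  ultimately show ?thesis by (simp add: power_add flip: power_mult_distrib)
qed

lemma blade_coeff_cocycle:
  assumes "finite \<mu>" "finite \<nu>" "finite \<rho>"
  shows "blade_coeff m \<mu> \<nu> * blade_coeff m (sym_diff \<mu> \<nu>) \<rho> =
         blade_coeff m \<nu> \<rho> * blade_coeff m \<mu> (sym_diff \<nu> \<rho>)"
proof -
  define I where "I = (\<lambda>A B :: nat set. {(i, j). i \<in> A \<and> j \<in> B \<and> j < i})"
  have fin: "finite (I A B)" if "finite A" "finite B" for A B
    by (rule finite_subset[of _ "A \<times> B"]) (use that in \<open>auto simp: I_def\<close>)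
  have "I (sym_diff \<mu> \<nu>) \<rho> = sym_diff (I \<mu> \<rho>) (I \<nu> \<rho>)"
    and "I \<mu> (sym_diff \<nu> \<rho>) = sym_diff (I \<mu> \<nu>) (I \<mu> \<rho>)" by (auto simp: I_def)
  then have sgn: "(- 1 :: 'a) ^ card (I (sym_diff \<mu> \<nu>) \<rho>) = (- 1) ^ card (I \<mu> \<rho>) * (- 1) ^ card (I \<nu> \<rho>)"
    "(- 1 :: 'a) ^ card (I \<mu> (sym_diff \<nu> \<rho>)) = (- 1) ^ card (I \<mu> \<nu>) * (- 1) ^ card (I \<mu> \<rho>)"
    using assms by (simp_all only: neg_one_power_card_sym_diff fin)
  have "(\<Prod>i\<in>\<mu> \<inter> \<nu>. m i) * (\<Prod>i\<in>sym_diff \<mu> \<nu> \<inter> \<rho>. m i) = (\<Prod>i\<in>(\<mu> \<inter> \<nu>) \<union> (sym_diff \<mu> \<nu> \<inter> \<rho>). m i)"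
    using assms by (intro prod.union_disjoint[symmetric]) auto
  also have "(\<mu> \<inter> \<nu>) \<union> (sym_diff \<mu> \<nu> \<inter> \<rho>) = (\<nu> \<inter> \<rho>) \<union> (\<mu> \<inter> sym_diff \<nu> \<rho>)" by auto
  also have "(\<Prod>i\<in>\<dots>. m i) = (\<Prod>i\<in>\<nu> \<inter> \<rho>. m i) * (\<Prod>i\<in>\<mu> \<inter> sym_diff \<nu> \<rho>. m i)"
    using assms by (intro prod.union_disjoint) auto
  finally have met: "(\<Prod>i\<in>\<mu> \<inter> \<nu>. m i) * (\<Prod>i\<in>sym_diff \<mu> \<nu> \<inter> \<rho>. m i) =
      (\<Prod>i\<in>\<nu> \<inter> \<rho>. m i) * (\<Prod>i\<in>\<mu> \<inter> sym_diff \<nu> \<rho>. m i)" .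
  have coeff: "blade_coeff m A B = (- 1) ^ card (I A B) * (\<Prod>i\<in>A \<inter> B. m i)" for A B
    by (simp add: blade_coeff_def I_def)
  have alg: "(a * p) * ((b * c) * q) = (c * p') * ((a * b) * q')" if "p * q = p' * q'"
    for a b c p q p' q' :: 'a
  proof -
    have "(a * p) * ((b * c) * q) = (a * b * c) * (p * q)" by (simp only: mult_ac)
    also have "\<dots> = (c * p') * ((a * b) * q')" unfolding that by (simp only: mult_ac)
    finally show ?thesis .
  qed
  show ?thesis unfolding coeff sgn by (rule alg[OF met])
qed

lemma geom_prod_assoc:
  "geom_prod d m (geom_prod d m A B) C = geom_prod d m A (geom_prod d m B C)"
proof
  fix \<rho>
  let ?P = "Pow {1..d}" and ?c = "blade_coeff m"
  have collapse: "(\<Sum>\<sigma>\<in>?P. blade \<tau> \<sigma> * f \<sigma>) = f \<tau>" if "\<tau> \<in> ?P" for \<tau> and f :: "nat set \<Rightarrow> 'a"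
  proof -
    have "(\<Sum>\<sigma>\<in>?P. blade \<tau> \<sigma> * f \<sigma>) = (\<Sum>\<sigma>\<in>?P. if \<sigma> = \<tau> then f \<sigma> else 0)"
      by (intro sum.cong) (auto simp: blade_def)
    also have "\<dots> = f \<tau>" using that by (subst sum.delta) auto
    finally show ?thesis .
  qed
  have "geom_prod d m (geom_prod d m A B) C \<rho> =
    (\<Sum>\<sigma>\<in>?P. \<Sum>\<tau>\<in>?P. \<Sum>\<mu>\<in>?P. \<Sum>\<nu>\<in>?P. blade (sym_diff \<mu> \<nu>) \<sigma> *
        (A \<mu> * B \<nu> * C \<tau> * ?c \<mu> \<nu> * ?c \<sigma> \<tau> * blade (sym_diff \<sigma> \<tau>) \<rho>))"
    unfolding geom_prod_def sum_distrib_right by (intro sum.cong refl) (simp only: mult_ac)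
  also have "\<dots> = (\<Sum>\<tau>\<in>?P. \<Sum>\<sigma>\<in>?P. \<Sum>\<mu>\<in>?P. \<Sum>\<nu>\<in>?P. blade (sym_diff \<mu> \<nu>) \<sigma> *
        (A \<mu> * B \<nu> * C \<tau> * ?c \<mu> \<nu> * ?c \<sigma> \<tau> * blade (sym_diff \<sigma> \<tau>) \<rho>))"
    by (rule sum.swap)
  also have "\<dots> = (\<Sum>\<tau>\<in>?P. \<Sum>\<mu>\<in>?P. \<Sum>\<sigma>\<in>?P. \<Sum>\<nu>\<in>?P. blade (sym_diff \<mu> \<nu>) \<sigma> *
        (A \<mu> * B \<nu> * C \<tau> * ?c \<mu> \<nu> * ?c \<sigma> \<tau> * blade (sym_diff \<sigma> \<tau>) \<rho>))"
    by (rule sum.cong[OF refl], rule sum.swap)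
  also have "\<dots> = (\<Sum>\<tau>\<in>?P. \<Sum>\<mu>\<in>?P. \<Sum>\<nu>\<in>?P. \<Sum>\<sigma>\<in>?P. blade (sym_diff \<mu> \<nu>) \<sigma> *
        (A \<mu> * B \<nu> * C \<tau> * ?c \<mu> \<nu> * ?c \<sigma> \<tau> * blade (sym_diff \<sigma> \<tau>) \<rho>))"
    by (rule sum.cong[OF refl], rule sum.cong[OF refl], rule sum.swap)
  also have "\<dots> = (\<Sum>\<tau>\<in>?P. \<Sum>\<mu>\<in>?P. \<Sum>\<nu>\<in>?P.
        A \<mu> * B \<nu> * C \<tau> * ?c \<mu> \<nu> * ?c (sym_diff \<mu> \<nu>) \<tau> * blade (sym_diff (sym_diff \<mu> \<nu>) \<tau>) \<rho>)"
    by (intro sum.cong refl, subst collapse) auto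
  also have "\<dots> = (\<Sum>\<tau>\<in>?P. \<Sum>\<mu>\<in>?P. \<Sum>\<nu>\<in>?P.
        A \<mu> * B \<nu> * C \<tau> * ?c \<nu> \<tau> * ?c \<mu> (sym_diff \<nu> \<tau>) * blade (sym_diff \<mu> (sym_diff \<nu> \<tau>)) \<rho>)"
  proof (intro sum.cong refl)
    fix \<tau> \<mu> \<nu> assume "\<tau> \<in> ?P" "\<mu> \<in> ?P" "\<nu> \<in> ?P"
    then have "finite \<mu>" "finite \<nu>" "finite \<tau>" by (auto intro: finite_subset)
    then have 1: "?c \<mu> \<nu> * ?c (sym_diff \<mu> \<nu>) \<tau> = ?c \<nu> \<tau> * ?c \<mu> (sym_diff \<nu> \<tau>)"
      by (rule blade_coeff_cocycle)
    have 2: "sym_diff (sym_diff \<mu> \<nu>) \<tau> = sym_diff \<mu> (sym_diff \<nu> \<tau>)" by auto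
    show "A \<mu> * B \<nu> * C \<tau> * ?c \<mu> \<nu> * ?c (sym_diff \<mu> \<nu>) \<tau> * blade (sym_diff (sym_diff \<mu> \<nu>) \<tau>) \<rho> =
      A \<mu> * B \<nu> * C \<tau> * ?c \<nu> \<tau> * ?c \<mu> (sym_diff \<nu> \<tau>) * blade (sym_diff \<mu> (sym_diff \<nu> \<tau>)) \<rho>"
      using arg_cong[OF 1, of "\<lambda>x. A \<mu> * B \<nu> * C \<tau> * x * blade (sym_diff \<mu> (sym_diff \<nu> \<tau>)) \<rho>"]
      unfolding 2 by (simp only: mult.assoc)
  qed
  also have "\<dots> = (\<Sum>\<mu>\<in>?P. \<Sum>\<tau>\<in>?P. \<Sum>\<nu>\<in>?P.
        A \<mu> * B \<nu> * C \<tau> * ?c \<nu> \<tau> * ?c \<mu> (sym_diff \<nu> \<tau>) * blade (sym_diff \<mu> (sym_diff \<nu> \<tau>)) \<rho>)"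
    by (rule sum.swap)
  also have "\<dots> = (\<Sum>\<mu>\<in>?P. \<Sum>\<nu>\<in>?P. \<Sum>\<tau>\<in>?P.
        A \<mu> * B \<nu> * C \<tau> * ?c \<nu> \<tau> * ?c \<mu> (sym_diff \<nu> \<tau>) * blade (sym_diff \<mu> (sym_diff \<nu> \<tau>)) \<rho>)"
    by (rule sum.cong[OF refl], rule sum.swap)
  also have "\<dots> = (\<Sum>\<mu>\<in>?P. \<Sum>\<nu>\<in>?P. \<Sum>\<tau>\<in>?P. \<Sum>\<sigma>\<in>?P. blade (sym_diff \<nu> \<tau>) \<sigma> *
        (A \<mu> * B \<nu> * C \<tau> * ?c \<nu> \<tau> * ?c \<mu> \<sigma> * blade (sym_diff \<mu> \<sigma>) \<rho>))"
    by (intro sum.cong refl, subst collapse) auto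
  also have "\<dots> = (\<Sum>\<mu>\<in>?P. \<Sum>\<nu>\<in>?P. \<Sum>\<sigma>\<in>?P. \<Sum>\<tau>\<in>?P. blade (sym_diff \<nu> \<tau>) \<sigma> *
        (A \<mu> * B \<nu> * C \<tau> * ?c \<nu> \<tau> * ?c \<mu> \<sigma> * blade (sym_diff \<mu> \<sigma>) \<rho>))"
    by (rule sum.cong[OF refl], rule sum.cong[OF refl], rule sum.swap)
  also have "\<dots> = (\<Sum>\<mu>\<in>?P. \<Sum>\<sigma>\<in>?P. \<Sum>\<nu>\<in>?P. \<Sum>\<tau>\<in>?P. blade (sym_diff \<nu> \<tau>) \<sigma> *
        (A \<mu> * B \<nu> * C \<tau> * ?c \<nu> \<tau> * ?c \<mu> \<sigma> * blade (sym_diff \<mu> \<sigma>) \<rho>))"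
    by (rule sum.cong[OF refl], rule sum.swap)
  also have "\<dots> = geom_prod d m A (geom_prod d m B C) \<rho>"
    unfolding geom_prod_def sum_distrib_right sum_distrib_left
    by (intro sum.cong refl) (simp only: mult_ac)
  finally show "geom_prod d m (geom_prod d m A B) C \<rho> = geom_prod d m A (geom_prod d m B C) \<rho>" .
qed

end

theory Submission
  imports Defs
begin

text \<open>
  For non-degenerate \<open>m\<close> all products of basis blades are non-zero, so the pairs to be counted
  are those with \<open>|\<mu>| = g\<^sub>a\<close> and \<open>|\<nu>| = g\<^sub>b\<close>.  Such a pair is determined by \<open>\<mu> \<triangle> \<nu>\<close>, its subset
  \<open>\<mu> - \<nu>\<close> and the subset \<open>\<mu> \<inter> \<nu>\<close> of its complement.  If \<open>|\<mu> \<inter> \<nu>| = q\<close>, these sets have sizes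
  \<open>g\<^sub>c = g\<^sub>a + g\<^sub>b - 2 q\<close>, \<open>g\<^sub>a - q\<close> and \<open>q\<close>, which gives the product of three binomial coefficients;
  \<open>0 \<le> q \<le> min g\<^sub>a g\<^sub>b\<close> corresponds to \<open>g\<^sub>c\<close> running through the grade set.
\<close>

lemma binom_of_nat: "binom (int n) (int k) = int (n choose k)"
  by (simp add: binom_def binomial_eq_0)

text \<open>Distinct blades have disjoint supports, so evaluating the sum at \<open>\<rho>\<close>
  leaves the single coefficient \<open>a \<rho>\<close>, or 0 when \<open>\<rho>\<close> is not an
  index.\<close>

lemma full_homogeneous_nonzero_iff:
  assumes "full_homogeneous d g A"
  shows "A \<rho> \<noteq> 0 \<longleftrightarrow> \<rho> \<subseteq> {1..d} \<and> card \<rho> = g"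
proof -
  let ?X = "{\<mu>. \<mu> \<subseteq> {1..d} \<and> card \<mu> = g}"
  obtain a where a: "\<forall>\<mu>. \<mu> \<subseteq> {1..d} \<and> card \<mu> = g \<longrightarrow> a \<mu> \<noteq> 0"
    and A: "A = (\<lambda>\<rho>. \<Sum>\<mu>\<in>?X. a \<mu> * blade \<mu> \<rho>)"
    using assms unfolding full_homogeneous_def by blast
  have "finite ?X" by simp
  have "A \<rho> = (\<Sum>\<mu>\<in>?X. if \<mu> = \<rho> then a \<mu> else 0)"
    unfolding A by (rule sum.cong) (auto simp: blade_def)
  also have "\<dots> = (if \<rho> \<in> ?X then a \<rho> else 0)"
    using \<open>finite ?X\<close> by (rule sum.delta)
  finally show ?thesis using a by auto
qed

text \<open>Non-degeneracy enters here: the scalar is a sign times a finite product of non-zero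
  \<open>m i\<close>, so the product does not vanish at \<open>sym_diff \<mu> \<nu>\<close>.\<close>

lemma geom_prod_blade_nonzero:
  fixes m :: "nat \<Rightarrow> 'a::field"
  assumes "\<forall>i\<in>{1..d}. m i \<noteq> 0" "\<mu> \<subseteq> {1..d}" "\<nu> \<subseteq> {1..d}"
  shows "geom_prod d m (blade \<mu>) (blade \<nu>) \<noteq> (\<lambda>_. 0)"
proof -
  have "finite (\<mu> \<inter> \<nu>)" using assms(2) by (meson finite_Int finite_atLeastAtMost finite_subset)
  then have "blade_coeff m \<mu> \<nu> \<noteq> 0"
    using assms by (auto simp: blade_coeff_def)
  then have "geom_prod d m (blade \<mu>) (blade \<nu>) (sym_diff \<mu> \<nu>) \<noteq> 0"
    using assms(2,3) by (simp add: geom_prod_blade) (simp add: blade_def)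
  then show ?thesis by (metis (full_types))
qed

text \<open>The bounds on \<open>q\<close> make the subtractions exact: \<open>a + b - 2 * q\<close>
  is the sum of the sizes \<open>a - q\<close> of \<open>\<mu> - \<nu>\<close> and
  \<open>b - q\<close> of \<open>\<nu> - \<mu>\<close>.\<close>

lemma card_pairs_inter:
  assumes "finite S" "q \<le> a" "q \<le> b"
  shows "card {(\<mu>, \<nu>). \<mu> \<subseteq> S \<and> \<nu> \<subseteq> S \<and> card \<mu> = a \<and> card \<nu> = b \<and> card (\<mu> \<inter> \<nu>) = q} =
    (card S choose (a + b - 2 * q)) * ((a + b - 2 * q) choose (a - q)) *
    ((card S - (a + b - 2 * q)) choose q)"
    (is "card ?P = ?rhs")
proof -
  let ?c = "a + b - 2 * q"
  let ?subsets = "\<lambda>T k. {\<sigma>. \<sigma> \<subseteq> T \<and> card \<sigma> = k}"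
  \<comment> \<open>A dependent sum, since the last two components are chosen inside
    \<open>\<sigma>\<close> and inside its complement; the sizes of both ranges depend only on
    \<open>card \<sigma>\<close>.\<close>
  let ?T = "SIGMA \<sigma>:?subsets S ?c. ?subsets \<sigma> (a - q) \<times> ?subsets (S - \<sigma>) q"
  have fin: "finite X" if "X \<subseteq> S" for X using that assms(1) by (rule finite_subset)
  have "bij_betw (\<lambda>(\<mu>, \<nu>). (sym_diff \<mu> \<nu>, \<mu> - \<nu>, \<mu> \<inter> \<nu>)) ?P ?T"
  \<comment> \<open>With \<open>\<alpha>\<close> as \<open>\<mu> - \<nu>\<close> and
    \<open>\<beta>\<close> as \<open>\<mu> \<inter> \<nu>\<close>, the remainder
    \<open>\<sigma> - \<alpha>\<close> is \<open>\<nu> - \<mu>\<close>, which recovers both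
    sets.\<close>
  proof (rule bij_betw_byWitness[where f' = "\<lambda>(\<sigma>, \<alpha>, \<beta>). (\<alpha> \<union> \<beta>, (\<sigma> - \<alpha>) \<union> \<beta>)"], goal_cases)
    case 1
    show ?case by auto
  next
    case 2
    show ?case by auto
  next
    case 3
    show ?case
    proof (rule image_subsetI)
      fix x assume "x \<in> ?P"
      then obtain \<mu> \<nu> where x: "x = (\<mu>, \<nu>)"
        and *: "\<mu> \<subseteq> S" "\<nu> \<subseteq> S" "card \<mu> = a" "card \<nu> = b" "card (\<mu> \<inter> \<nu>) = q"
        by blast
      have d: "card (\<mu> - \<nu>) = a - q" "card (\<nu> - \<mu>) = b - q"
        using * fin by (simp_all add: card_Diff_subset_Int Int_commute)
      have "card (sym_diff \<mu> \<nu>) = card (\<mu> - \<nu>) + card (\<nu> - \<mu>)"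
        using * fin by (intro card_Un_disjoint) auto
      then have "card (sym_diff \<mu> \<nu>) = ?c" using d assms(2,3) by simp
      then show "(\<lambda>(\<mu>, \<nu>). (sym_diff \<mu> \<nu>, \<mu> - \<nu>, \<mu> \<inter> \<nu>)) x \<in> ?T"
        using * d unfolding x by auto
    qed
  next
    case 4
    show ?case
    proof (rule image_subsetI)
      fix x assume "x \<in> ?T"
      then obtain \<sigma> \<alpha> \<beta> where x: "x = (\<sigma>, \<alpha>, \<beta>)"
        and *: "\<sigma> \<subseteq> S" "card \<sigma> = ?c" "\<alpha> \<subseteq> \<sigma>" "card \<alpha> = a - q" "\<beta> \<subseteq> S - \<sigma>" "card \<beta> = q"
        by blast
      have f: "finite \<sigma>" "finite \<alpha>" "finite \<beta>" using * by (blast intro: fin)+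
      have "card (\<alpha> \<union> \<beta>) = card \<alpha> + card \<beta>"
        using * f by (intro card_Un_disjoint) auto
      moreover have "card ((\<sigma> - \<alpha>) \<union> \<beta>) = card (\<sigma> - \<alpha>) + card \<beta>"
        using * f by (intro card_Un_disjoint) auto
      moreover have "card (\<sigma> - \<alpha>) = card \<sigma> - card \<alpha>"
        using * f by (intro card_Diff_subset) auto
      ultimately have "card (\<alpha> \<union> \<beta>) = a" "card ((\<sigma> - \<alpha>) \<union> \<beta>) = b"
        using * assms(2,3) by simp_all
      moreover have "(\<alpha> \<union> \<beta>) \<inter> ((\<sigma> - \<alpha>) \<union> \<beta>) = \<beta>" using * by auto
      ultimately show "(\<lambda>(\<sigma>, \<alpha>, \<beta>). (\<alpha> \<union> \<beta>, (\<sigma> - \<alpha>) \<union> \<beta>)) x \<in> ?P"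
        using * unfolding x by auto
    qed
  qed
  then have "card ?P = card ?T" by (rule bij_betw_same_card)
  also have "\<dots> = (\<Sum>\<sigma>\<in>?subsets S ?c. card (?subsets \<sigma> (a - q) \<times> ?subsets (S - \<sigma>) q))"
    using assms(1) fin by (intro card_SigmaI) auto
  also have "\<dots> = (\<Sum>\<sigma>\<in>?subsets S ?c. (?c choose (a - q)) * ((card S - ?c) choose q))"
    using assms(1) fin by (intro sum.cong) (auto simp: card_cartesian_product n_subsets card_Diff_subset)
  also have "\<dots> = ?rhs"
    using assms(1) by (simp add: n_subsets)
  finally show ?thesis .
qed

lemma card_pairs:
  assumes "finite S"
  shows "card {(\<mu>, \<nu>). \<mu> \<subseteq> S \<and> \<nu> \<subseteq> S \<and> card \<mu> = a \<and> card \<nu> = b} =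
    (\<Sum>q\<le>min a b. (card S choose (a + b - 2 * q)) * ((a + b - 2 * q) choose (a - q)) *
      ((card S - (a + b - 2 * q)) choose q))"
proof -
  let ?P = "\<lambda>q. {(\<mu>, \<nu>). \<mu> \<subseteq> S \<and> \<nu> \<subseteq> S \<and> card \<mu> = a \<and> card \<nu> = b \<and> card (\<mu> \<inter> \<nu>) = q}"
  have fin: "finite (?P q)" for q
    by (rule finite_subset[of _ "Pow S \<times> Pow S"]) (use assms in auto)
  have "card (\<mu> \<inter> \<nu>) \<le> min (card \<mu>) (card \<nu>)" if "\<mu> \<subseteq> S" "\<nu> \<subseteq> S" for \<mu> \<nu>
    using that assms by (simp add: card_mono finite_subset)
  then have "{(\<mu>, \<nu>). \<mu> \<subseteq> S \<and> \<nu> \<subseteq> S \<and> card \<mu> = a \<and> card \<nu> = b} = (\<Union>q\<le>min a b. ?P q)"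
    by auto
  also have "card \<dots> = (\<Sum>q\<le>min a b. card (?P q))"
    using fin by (intro card_UN_disjoint) auto
  finally show ?thesis using assms by (simp add: card_pairs_inter)
qed

text \<open>The definition counts upwards from the smallest grade, the pair count downwards from
  \<open>a + b\<close>; the two parameters are related by \<open>q = min a b - k\<close>.\<close>

lemma grade_set_eq:
  "grade_set (int a) (int b) = (\<lambda>q. int a + int b - 2 * int q) ` {..min a b}"
proof -
  have abs: "\<bar>int a - int b\<bar> = int a + int b - 2 * int (min a b)" by auto
  have "g \<in> grade_set (int a) (int b) \<longleftrightarrow> (\<exists>q\<le>min a b. g = int a + int b - 2 * int q)" for g
  proof
    assume "g \<in> grade_set (int a) (int b)"
    then obtain k where "g = \<bar>int a - int b\<bar> + 2 * int k" "g \<le> int a + int b"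
      by (auto simp: grade_set_def)
    \<comment> \<open>The bound \<open>g \<le> int a + int b\<close> forces
      \<open>k \<le> min a b\<close>, so the natural subtraction is not truncated.\<close>
    then have "g = int a + int b - 2 * int (min a b - k)" unfolding abs by linarith
    then show "\<exists>q\<le>min a b. g = int a + int b - 2 * int q" by (metis diff_le_self)
  next
    assume "\<exists>q\<le>min a b. g = int a + int b - 2 * int q"
    then obtain q where "q \<le> min a b" "g = int a + int b - 2 * int q" by blast
    then have "g = \<bar>int a - int b\<bar> + 2 * int (min a b - q) \<and> g \<le> int a + int b"
      unfolding abs by linarith
    then show "g \<in> grade_set (int a) (int b)" unfolding grade_set_def by blast
  qed
  then show ?thesis by auto
qed

lemma sum_grade_set:
  "(\<Sum>gc\<in>grade_set (int a) (int b). f gc) = (\<Sum>q\<le>min a b. f (int a + int b - 2 * int q))"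
  unfolding grade_set_eq by (subst sum.reindex) (auto simp: inj_on_def)

theorem theorem4p1:
  fixes d ga gb :: nat
    and m :: "nat \<Rightarrow> 'a::field"
    and A B :: "'a multivector"
  assumes "1 \<le> d" and "ga \<le> d" and "gb \<le> d"
    and "\<forall>i\<in>{1..d}. m i \<noteq> 0"
    and "full_homogeneous d ga A"
    and "full_homogeneous d gb B"
  shows "int (geom_prod_ops d m A B) =
    2 * (\<Sum>gc\<in>grade_set (int ga) (int gb).
           binom (int d) gc
         * binom gc ((int ga - int gb + gc) div 2)
         * binom (int d - gc) ((int ga + int gb - gc) div 2))"
proof -
  let ?t = "\<lambda>q. (d choose (ga + gb - 2 * q)) * ((ga + gb - 2 * q) choose (ga - q)) *
      ((d - (ga + gb - 2 * q)) choose q)"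
  let ?b = "\<lambda>gc. binom (int d) gc * binom gc ((int ga - int gb + gc) div 2)
         * binom (int d - gc) ((int ga + int gb - gc) div 2)"
  have "contributing_pairs d m A B =
      {(\<mu>, \<nu>). \<mu> \<subseteq> {1..d} \<and> \<nu> \<subseteq> {1..d} \<and> card \<mu> = ga \<and> card \<nu> = gb}"
    unfolding contributing_pairs_def full_homogeneous_nonzero_iff[OF assms(5)]
      full_homogeneous_nonzero_iff[OF assms(6)]
    using geom_prod_blade_nonzero[OF assms(4)] by (intro Collect_cong) (simp only: split_beta, metis)
  then have "geom_prod_ops d m A B = 2 * (\<Sum>q\<le>min ga gb. ?t q)"
    using card_pairs[of "{1..d}" ga gb] by (simp add: geom_prod_ops_def case_prod_unfold)
  moreover have "int (?t q) = ?b (int ga + int gb - 2 * int q)" if "q \<le> min ga gb" for q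
  proof -
    let ?c = "ga + gb - 2 * q"
    have c: "int ga + int gb - 2 * int q = int ?c" using that by auto
    \<comment> \<open>Both numerators are even, \<open>2 * (ga - q)\<close> and
      \<open>2 * q\<close>, so the integer divisions are exact.\<close>
    have p: "(int ga - int gb + int ?c) div 2 = int (ga - q)"
      and r: "(int ga + int gb - int ?c) div 2 = int q" using that by auto
    show ?thesis
    proof (cases "?c \<le> d")
      case True
      then have "int d - int ?c = int (d - ?c)" by simp
      then show ?thesis unfolding c p r by (simp only: binom_of_nat of_nat_mult)
    next
      \<comment> \<open>Here \<open>d - ?c\<close> truncates to 0 while
        \<open>int d - int ?c\<close> is negative, so the third factors can differ (at
        \<open>q = 0\<close>); the common first factor \<open>d choose ?c\<close> is 0 and makes
        both sides vanish.\<close>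
      case False
      then show ?thesis unfolding c p r binom_of_nat by (simp add: binomial_eq_0)
    qed
  qed
  ultimately show ?thesis by (simp add: sum_grade_set)
qed

end
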